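(* For every mixed graph $G$ there is a one-to-one correspondence (bijection) between the multiset $\mathcal{S}(G)$ of all mixed components of $G$ and the set of all connected components of the associated graph $G^A$.
   Context: A mixed graph $G$ has a finite nonempty vertex set $V_G=\{v_1,\dots,v_n\}$, a finite set $E_G$ of (undirected) edges, each joining an unordered pair of vertices $\{u,v\}$ (a loop if $u=v$), and a finite set $\vec E_G$ of arcs, each going from $u$ to $v$ for an ordered pair $(u,v)$ of vertices (a directed loop if $u=v$); multiple edges, loops, arcs and directed loops are allowed. The out-degree (in-degree) of $u$ is the number of arcs starting (ending) at $u$. A submixed graph of $G$ is given by subsets of the vertices, edges and arcs, with the restricted incidences. The undirected part $G_u$ is the graph with vertex set $V_G$ and edge set $E_G$ (no arcs). A mixed graph is called a graph if it has no arcs; components are connected components (for mixed graphs, ignoring directions of arcs). Associated graph: $G^A$ is the undirected graph with vertex set $\{v'_1,\dots,v'_n,v''_1,\dots,v''_n\}$ in which each edge of $G$ joining $v_i$ and $v_j$ gives one edge joining $v'_i,v'_j$ and one edge joining $v''_i,v''_j$ (a loop at $v_i$ gives a loop at $v'_i$ and a loop at $v''_i$), each arc of $G$ from $v_i$ to $v_j$ gives one edge joining $v'_i$ and $v''_j$, and there are no other edges. A walk in $G$ is a sequence $u_1,e_1,u_2,\dots,e_k,u_{k+1}$ where each $e_j$ is an edge joining $u_j,u_{j+1}$, or an arc from $u_j$ to $u_{j+1}$ (traversed forward), or an arc from $u_{j+1}$ to $u_j$ (traversed backward); a directed loop may be regarded as traversed in either direction. It is closed if $u_1=u_{k+1}$.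 An alternating walk is a walk containing at least one arc in which, starting from the first arc, successive arcs alternate between forward and backward direction. Numbers of arcs in a walk are counted with repetition. A submixed graph $G'$ of $G$ with at least one arc is a special submixed graph of $G$ if: (i) any two distinct vertices of $G'$ are joined by an alternating walk in $G'$; (ii) if a component $H$ of $G'_u$ has at least one vertex at which some arc of $G'$ ends and at least one vertex at which some arc of $G'$ starts, then for each vertex $v$ of $H$ there is a closed alternating walk in $G'$ starting and ending at $v$ and containing an odd number of arcs. A submixed graph $G'$ of $G$ is a mixed component of $G$ if it is one of: Type I: a component of $G_u$ each of whose vertices has out-degree zero in $G$; Type II: a component of $G_u$ each of whose vertices has in-degree zero in $G$; Type III: a maximal special submixed graph of $G$ (with respect to inclusion). $\mathcal{S}(G)$ is the multiset of all mixed components of $G$, where a component of $G$ that is a graph (has no arcs) is taken twice, once as a Type I and once as a Type II mixed component. *)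

theory Defs
  imports Main "HOL-Library.Multiset" "HOL-Library.Uprod"
begin

record ('v, 'e, 'a) pre_mixed_graph =
  verts :: "'v set"
  edges :: "'e set"
  arcs :: "'a set"
  ends :: "'e \<Rightarrow> 'v uprod"
  tail :: "'a \<Rightarrow> 'v"
  head :: "'a \<Rightarrow> 'v"

locale mixed_graph =
  fixes G :: "('v, 'e, 'a) pre_mixed_graph"
  assumes finite_verts: "finite (verts G)"
    and verts_nonempty: "verts G \<noteq> {}"
    and finite_edges: "finite (edges G)"
    and finite_arcs: "finite (arcs G)"
    and ends_in_verts: "e \<in> edges G \<Longrightarrow> set_uprod (ends G e) \<subseteq> verts G"
    and tail_in_verts: "a \<in> arcs G \<Longrightarrow> tail G a \<in> verts G"
    and head_in_verts: "a \<in> arcs G \<Longrightarrow> head G a \<in> verts G"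

definition out_degree :: "('v, 'e, 'a) pre_mixed_graph \<Rightarrow> 'v \<Rightarrow> nat" where
  "out_degree G u = card {a \<in> arcs G. tail G a = u}"

definition in_degree :: "('v, 'e, 'a) pre_mixed_graph \<Rightarrow> 'v \<Rightarrow> nat" where
  "in_degree G u = card {a \<in> arcs G. head G a = u}"

text \<open>The incidence functions are total, and a submixed graph keeps those of the ambient graph
  unchanged. Hence a submixed graph is determined by its three sets, and inclusion is
  antisymmetric.\<close>

definition submixed ::
    "('v, 'e, 'a) pre_mixed_graph \<Rightarrow> ('v, 'e, 'a) pre_mixed_graph \<Rightarrow> bool" where
  "submixed H G \<longleftrightarrow> mixed_graph H \<and>
     verts H \<subseteq> verts G \<and> edges H \<subseteq> edges G \<and> arcs H \<subseteq> arcs G \<and>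
     ends H = ends G \<and> tail H = tail G \<and> head H = head G"

definition undirected_part ::
    "('v, 'e, 'a) pre_mixed_graph \<Rightarrow> ('v, 'e, 'a) pre_mixed_graph" where
  "undirected_part G = G\<lparr>arcs := {}\<rparr>"

text \<open>A walk is given by its start vertex, its list of steps and its end vertex; the inner
  vertices are determined by these. A directed loop can be used in a forward or a backward
  step.\<close>

datatype ('e, 'a) step = Along 'e | Forward 'a | Backward 'a

inductive walk ::
    "('v, 'e, 'a) pre_mixed_graph \<Rightarrow> 'v \<Rightarrow> ('e, 'a) step list \<Rightarrow> 'v \<Rightarrow> bool"
  for G where
  Nil: "u \<in> verts G \<Longrightarrow> walk G u [] u"
| Along: "e \<in> edges G \<Longrightarrow> ends G e = Upair u v \<Longrightarrow> walk G v ss w \<Longrightarrow> walk G u (Along e # ss) w"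
| Forward: "a \<in> arcs G \<Longrightarrow> walk G (head G a) ss w \<Longrightarrow> walk G (tail G a) (Forward a # ss) w"
| Backward: "a \<in> arcs G \<Longrightarrow> walk G (tail G a) ss w \<Longrightarrow> walk G (head G a) (Backward a # ss) w"

text \<open>The directions of the successive arcs of a walk (with repetition), \<open>True\<close> meaning
  forward.\<close>

fun arc_directions :: "('e, 'a) step list \<Rightarrow> bool list" where
  "arc_directions [] = []"
| "arc_directions (Along e # ss) = arc_directions ss"
| "arc_directions (Forward a # ss) = True # arc_directions ss"
| "arc_directions (Backward a # ss) = False # arc_directions ss"

definition alternating :: "('e, 'a) step list \<Rightarrow> bool" where
  "alternating ss \<longleftrightarrow> arc_directions ss \<noteq> [] \<and> distinct_adj (arc_directions ss)"

definition num_arcs :: "('e, 'a) step list \<Rightarrow> nat" where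
  "num_arcs ss = length (arc_directions ss)"

definition connected_mixed :: "('v, 'e, 'a) pre_mixed_graph \<Rightarrow> bool" where
  "connected_mixed G \<longleftrightarrow> (\<forall>u\<in>verts G. \<forall>v\<in>verts G. \<exists>ss. walk G u ss v)"

definition component ::
    "('v, 'e, 'a) pre_mixed_graph \<Rightarrow> ('v, 'e, 'a) pre_mixed_graph \<Rightarrow> bool" where
  "component H G \<longleftrightarrow> submixed H G \<and> connected_mixed H \<and>
     (\<forall>K. submixed K G \<and> connected_mixed K \<and> submixed H K \<longrightarrow> K = H)"

text \<open>The vertices \<open>v'\<close> and \<open>v''\<close> are \<open>Inl v\<close> and \<open>Inr v\<close>. The edges \<open>Inl (Inl e)\<close> and
  \<open>Inl (Inr e)\<close> are the two copies of the edge \<open>e\<close>, and \<open>Inr a\<close> is the edge coming from the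
  arc \<open>a\<close>.\<close>

definition associated_graph ::
    "('v, 'e, 'a) pre_mixed_graph \<Rightarrow> ('v + 'v, ('e + 'e) + 'a, 'a) pre_mixed_graph" where
  "associated_graph G =
     \<lparr>verts = verts G <+> verts G,
      edges = (edges G <+> edges G) <+> arcs G,
      arcs = {},
      ends = case_sum
        (case_sum (\<lambda>e. map_uprod Inl (ends G e)) (\<lambda>e. map_uprod Inr (ends G e)))
        (\<lambda>a. Upair (Inl (tail G a)) (Inr (head G a))),
      tail = undefined,
      head = undefined\<rparr>"

definition special ::
    "('v, 'e, 'a) pre_mixed_graph \<Rightarrow> ('v, 'e, 'a) pre_mixed_graph \<Rightarrow> bool" where
  "special K G \<longleftrightarrow> submixed K G \<and> arcs K \<noteq> {} \<and>
     (\<forall>u\<in>verts K. \<forall>v\<in>verts K. u \<noteq> v \<longrightarrow> (\<exists>ss. walk K u ss v \<and> alternating ss)) \<and>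
     (\<forall>H. component H (undirected_part K) \<and>
          (\<exists>a\<in>arcs K. head K a \<in> verts H) \<and> (\<exists>a\<in>arcs K. tail K a \<in> verts H) \<longrightarrow>
        (\<forall>v\<in>verts H. \<exists>ss. walk K v ss v \<and> alternating ss \<and> odd (num_arcs ss)))"

definition type_I ::
    "('v, 'e, 'a) pre_mixed_graph \<Rightarrow> ('v, 'e, 'a) pre_mixed_graph \<Rightarrow> bool" where
  "type_I H G \<longleftrightarrow> component H (undirected_part G) \<and> (\<forall>v\<in>verts H. out_degree G v = 0)"

definition type_II ::
    "('v, 'e, 'a) pre_mixed_graph \<Rightarrow> ('v, 'e, 'a) pre_mixed_graph \<Rightarrow> bool" where
  "type_II H G \<longleftrightarrow> component H (undirected_part G) \<and> (\<forall>v\<in>verts H. in_degree G v = 0)"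

definition type_III ::
    "('v, 'e, 'a) pre_mixed_graph \<Rightarrow> ('v, 'e, 'a) pre_mixed_graph \<Rightarrow> bool" where
  "type_III H G \<longleftrightarrow> special H G \<and> (\<forall>K. special K G \<and> submixed H K \<longrightarrow> K = H)"

definition mixed_component ::
    "('v, 'e, 'a) pre_mixed_graph \<Rightarrow> ('v, 'e, 'a) pre_mixed_graph \<Rightarrow> bool" where
  "mixed_component H G \<longleftrightarrow> type_I H G \<or> type_II H G \<or> type_III H G"

text \<open>Every mixed component occurs once, and a component of \<open>G\<close> without arcs once more. Both
  sets are finite for a mixed graph \<open>G\<close>, because \<open>G\<close> has only finitely many submixed graphs.\<close>

definition mixed_components ::
    "('v, 'e, 'a) pre_mixed_graph \<Rightarrow> ('v, 'e, 'a) pre_mixed_graph multiset" where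
  "mixed_components G =
     mset_set {H. mixed_component H G} + mset_set {H. component H G \<and> arcs H = {}}"

lemma finite_submixed:
  assumes "mixed_graph G"
  shows "finite {H. submixed H G}"
proof -
  interpret mixed_graph G by fact
  let ?f = "\<lambda>(V, E, A). G\<lparr>verts := V, edges := E, arcs := A\<rparr>"
  have "H \<in> ?f ` (Pow (verts G) \<times> Pow (edges G) \<times> Pow (arcs G))" if "submixed H G" for H
  proof -
    have "H = ?f (verts H, edges H, arcs H)"
      using that by (cases H) (auto simp: submixed_def)
    then show ?thesis
      using that by (auto simp: submixed_def intro!: image_eqI)
  qed
  then have "{H. submixed H G} \<subseteq> ?f ` (Pow (verts G) \<times> Pow (edges G) \<times> Pow (arcs G))"
    by blast
  then show ?thesis
    by (rule finite_subset) (simp add: finite_verts finite_edges finite_arcs)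
qed

text \<open>The elements of a multiset \<open>M\<close>, taken with multiplicity.\<close>

definition occurrences :: "'b multiset \<Rightarrow> ('b \<times> nat) set" where
  "occurrences M = {(x, i). i < count M x}"

end

theory Submission imports Defs begin

text \<open>
  The idea is that a walk in the associated graph \<open>G\<^sup>A\<close> is the same thing as a walk in \<open>G\<close> whose
  arcs alternate in direction. Call the vertices \<open>v'\<close> the upper sheet and the vertices \<open>v''\<close> the
  lower sheet. An edge of \<open>G\<close> is traversed within a sheet, and an arc changes the sheet: it leaves
  the upper sheet if traversed forward and the lower one if traversed backward. So the sheet that
  a walk of \<open>G\<^sup>A\<close> has reached dictates the direction of its next arc, which makes the
  directions alternate, and the walk ends on the other sheet iff it has an odd number of arcs
  (\<open>walk_project\<close>, \<open>walk_lift\<close>).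

  Every component \<open>C\<close> of \<open>G\<^sup>A\<close> has a shadow in \<open>G\<close>, the submixed graph of everything with a
  copy in \<open>C\<close>. Three kinds of components can have a given shadow \<open>H\<close>.

  If \<open>C\<close> contains no edge coming from an arc, it lies on one sheet and is the copy of \<open>H\<close> on that
  sheet. The copy on the upper sheet is a component iff \<open>H\<close> is a component of \<open>G\<^sub>u\<close> at which no arc
  starts, which is Type I; on the lower sheet one gets Type II in the same way
  (\<open>component_sheet_iff\<close>).

  If \<open>C\<close> contains an edge coming from an arc, its shadow is special (\<open>special_shadow\<close>): two
  vertices are joined by a walk through that arc, and if an undirected component of the shadow has
  vertices where arcs start and vertices where arcs end, then \<open>C\<close> contains both copies of it, and a
  walk from \<open>v'\<close> to \<open>v''\<close> is an odd closed alternating walk at \<open>v\<close>. Conversely, every special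
  submixed graph lies in the shadow of one component (\<open>special_subset_shadow\<close>); condition (ii) is
  what connects two arcs when the alternating walk given by condition (i) arrives on the wrong
  sheet. An arc has only one copy in \<open>G\<^sup>A\<close>, so the shadows with arcs are exactly the maximal special
  submixed graphs, and each belongs to a unique component (\<open>type_III_iff\<close>, \<open>component_unique_arc\<close>).

  Hence the number of components with shadow \<open>H\<close> is the number of types that \<open>H\<close> has. A graph has
  both Type I and Type II iff it is a component of \<open>G\<close> without arcs (\<open>type_I_and_II_iff\<close>), so this
  number is the multiplicity of \<open>H\<close> in \<open>\<S>(G)\<close>.
\<close>

section \<open>Walks and components\<close>

lemma walk_ends_in_verts:
  assumes "mixed_graph G" "walk G u ss v"
  shows "u \<in> verts G" "v \<in> verts G"
proof -
  interpret mixed_graph G by fact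
  show "u \<in> verts G"
    using assms(2) ends_in_verts tail_in_verts head_in_verts by cases force+
  show "v \<in> verts G"
    using assms(2) by induction
qed

lemma walk_append: "walk G u ss v \<Longrightarrow> walk G v ts w \<Longrightarrow> walk G u (ss @ ts) w"
  by (induction rule: walk.induct) (auto intro: walk.intros)

fun reverse_step :: "('e, 'a) step \<Rightarrow> ('e, 'a) step" where
  "reverse_step (Along e) = Along e"
| "reverse_step (Forward a) = Backward a"
| "reverse_step (Backward a) = Forward a"

lemma walk_reverse:
  assumes "mixed_graph G" "walk G u ss v"
  shows "walk G v (rev (map reverse_step ss)) u"
  using assms(2)
proof induction
  case (Nil u)
  then show ?case by (auto intro: walk.Nil)
next
  case (Along e u v ss w)
  then have "u \<in> verts G"
    using assms(1) by (force simp: mixed_graph_def)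
  then have "walk G v [Along e] u"
    using Along by (intro walk.Along[of _ _ _ u] walk.Nil) auto
  then show ?case
    using Along.IH by (auto intro: walk_append)
next
  case (Forward a ss w)
  then have "walk G (head G a) [Backward a] (tail G a)"
    using assms(1) by (intro walk.Backward walk.Nil) (auto simp: mixed_graph_def)
  then show ?case
    using Forward.IH by (auto intro: walk_append)
next
  case (Backward a ss w)
  then have "walk G (tail G a) [Forward a] (head G a)"
    using assms(1) by (intro walk.Forward walk.Nil) (auto simp: mixed_graph_def)
  then show ?case
    using Backward.IH by (auto intro: walk_append)
qed

lemma walk_submixed:
  assumes "submixed H G" "walk H u ss v"
  shows "walk G u ss v"
  using assms(2)
proof induction
  case (Nil u)
  then show ?case using assms(1) by (auto simp: submixed_def intro: walk.Nil)
next
  case (Along e u v ss w)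
  then show ?case using assms(1) by (auto simp: submixed_def intro: walk.Along)
next
  case (Forward a ss w)
  then have "a \<in> arcs G" "walk G (head G a) ss w" "tail H a = tail G a"
    using assms(1) by (auto simp: submixed_def)
  then show ?case by (auto intro: walk.Forward)
next
  case (Backward a ss w)
  then have "a \<in> arcs G" "walk G (tail G a) ss w" "head H a = head G a"
    using assms(1) by (auto simp: submixed_def)
  then show ?case by (auto intro: walk.Backward)
qed

definition joined :: "('v, 'e, 'a) pre_mixed_graph \<Rightarrow> 'v \<Rightarrow> 'v \<Rightarrow> bool" where
  "joined G u v \<longleftrightarrow> (\<exists>ss. walk G u ss v)"

lemma joined_refl: "u \<in> verts G \<Longrightarrow> joined G u u"
  unfolding joined_def by (blast intro: walk.Nil)

lemma joined_trans: "joined G u v \<Longrightarrow> joined G v w \<Longrightarrow> joined G u w"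
  unfolding joined_def by (blast intro: walk_append)

lemma joined_sym: "mixed_graph G \<Longrightarrow> joined G u v \<Longrightarrow> joined G v u"
  unfolding joined_def by (blast intro: walk_reverse)

lemma joined_edge:
  assumes "mixed_graph G" "e \<in> edges G" "ends G e = Upair u v"
  shows "joined G u v"
proof -
  have "v \<in> verts G"
    using assms by (force simp: mixed_graph_def)
  then show ?thesis
    unfolding joined_def using assms by (blast intro: walk.Along walk.Nil)
qed

lemma joined_arc:
  assumes "mixed_graph G" "a \<in> arcs G"
  shows "joined G (tail G a) (head G a)"
proof -
  have "head G a \<in> verts G"
    using assms by (force simp: mixed_graph_def)
  then show ?thesis
    unfolding joined_def using assms by (blast intro: walk.Forward walk.Nil)
qed

lemma submixed_trans: "submixed H K \<Longrightarrow> submixed K G \<Longrightarrow> submixed H G"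
  by (auto simp: submixed_def)

lemma submixed_antisym: "submixed H G \<Longrightarrow> submixed G H \<Longrightarrow> H = G"
  by (auto simp: submixed_def)

definition saturated ::
    "('v, 'e, 'a) pre_mixed_graph \<Rightarrow> ('v, 'e, 'a) pre_mixed_graph \<Rightarrow> bool" where
  "saturated C G \<longleftrightarrow> submixed C G \<and>
     (\<forall>e\<in>edges G. set_uprod (ends G e) \<inter> verts C \<noteq> {} \<longrightarrow> e \<in> edges C) \<and>
     (\<forall>a\<in>arcs G. tail G a \<in> verts C \<or> head G a \<in> verts C \<longrightarrow> a \<in> arcs C)"

lemma saturated_edge:
  "saturated C G \<Longrightarrow> e \<in> edges G \<Longrightarrow> v \<in> set_uprod (ends G e) \<Longrightarrow> v \<in> verts C \<Longrightarrow> e \<in> edges C"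
  by (auto simp: saturated_def)

lemma walk_in_saturated:
  assumes "saturated C G" "walk G u ss v" "u \<in> verts C"
  shows "walk C u ss v"
  using assms(2,3)
proof induction
  case (Nil u)
  then show ?case by (blast intro: walk.Nil)
next
  case (Along e u v ss w)
  then have "e \<in> edges C" "ends C e = Upair u v"
    using assms(1) by (auto simp: saturated_def submixed_def)
  moreover from this have "v \<in> verts C"
    using assms(1) by (force simp: saturated_def submixed_def mixed_graph_def)
  ultimately show ?case
    using Along.IH by (blast intro: walk.Along)
next
  case (Forward a ss w)
  have C: "tail C = tail G" "head C = head G" "mixed_graph C"
    using assms(1) by (auto simp: saturated_def submixed_def)
  have a: "a \<in> arcs C"
    using Forward assms(1) by (auto simp: saturated_def)
  then have "head G a \<in> verts C"
    using C by (metis mixed_graph.head_in_verts)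
  then show ?case
    using Forward.IH walk.Forward[OF a] C by simp
next
  case (Backward a ss w)
  have C: "tail C = tail G" "head C = head G" "mixed_graph C"
    using assms(1) by (auto simp: saturated_def submixed_def)
  have a: "a \<in> arcs C"
    using Backward assms(1) by (auto simp: saturated_def)
  then have "tail G a \<in> verts C"
    using C by (metis mixed_graph.tail_in_verts)
  then show ?case
    using Backward.IH walk.Backward[OF a] C by simp
qed

definition component_at ::
    "('v, 'e, 'a) pre_mixed_graph \<Rightarrow> 'v \<Rightarrow> ('v, 'e, 'a) pre_mixed_graph" where
  "component_at G u = G\<lparr>verts := {v. joined G u v},
     edges := {e \<in> edges G. \<forall>v\<in>set_uprod (ends G e). joined G u v},
     arcs := {a \<in> arcs G. joined G u (tail G a) \<and> joined G u (head G a)}\<rparr>"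

lemma saturated_component_at:
  assumes G: "mixed_graph G" and u: "u \<in> verts G"
  shows "saturated (component_at G u) G"
proof -
  interpret mixed_graph G by fact
  have sub: "{v. joined G u v} \<subseteq> verts G"
    using walk_ends_in_verts(2)[OF G] by (auto simp: joined_def)
  have "submixed (component_at G u) G"
    using sub joined_refl[OF u] finite_edges finite_arcs finite_subset[OF sub finite_verts]
    by (auto simp: submixed_def component_at_def mixed_graph_def)
  moreover have "e \<in> edges (component_at G u)"
    if e: "e \<in> edges G" and x: "set_uprod (ends G e) \<inter> verts (component_at G u) \<noteq> {}" for e
  proof -
    obtain p q where "ends G e = Upair p q"
      by (cases "ends G e")
    moreover from this have "joined G p q" "joined G q p"
      using joined_edge[OF G e] by auto
    ultimately show ?thesis
      using e x by (auto simp: component_at_def intro: joined_trans)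
  qed
  moreover have "a \<in> arcs (component_at G u)"
    if "a \<in> arcs G" "tail G a \<in> verts (component_at G u) \<or> head G a \<in> verts (component_at G u)"
    for a
    using that joined_arc[OF G that(1)] joined_sym[OF G joined_arc[OF G that(1)]]
    by (auto simp: component_at_def intro: joined_trans)
  ultimately show ?thesis
    by (simp add: saturated_def)
qed

lemma connected_component_at:
  assumes G: "mixed_graph G" and u: "u \<in> verts G"
  shows "connected_mixed (component_at G u)"
proof -
  have "\<exists>ss. walk (component_at G u) v ss w" if vw: "joined G u v" "joined G u w" for v w
  proof -
    obtain ss where "walk G v ss w"
      using joined_trans[OF joined_sym[OF G vw(1)] vw(2)] by (auto simp: joined_def)
    moreover have "v \<in> verts (component_at G u)"
      using vw by (simp add: component_at_def)
    ultimately show ?thesis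
      using walk_in_saturated[OF saturated_component_at[OF G u]] by blast
  qed
  then show ?thesis
    by (simp add: connected_mixed_def component_at_def)
qed

text \<open>This replaces maximality by a local condition: a walk that starts in a saturated submixed
  graph never leaves it, so no connected submixed graph properly contains it.\<close>

lemma component_iff:
  assumes G: "mixed_graph G"
  shows "component C G \<longleftrightarrow> saturated C G \<and> connected_mixed C"
proof
  assume C: "component C G"
  then have sub: "submixed C G" and con: "connected_mixed C"
    by (auto simp: component_def)
  then obtain u where u: "u \<in> verts C"
    by (auto simp: submixed_def mixed_graph_def)
  have uG: "u \<in> verts G"
    using u sub by (auto simp: submixed_def)
  interpret C: mixed_graph C
    using sub by (simp add: submixed_def)
  have joined: "joined G u v" if "v \<in> verts C" for v
    using con u that walk_submixed[OF sub] unfolding connected_mixed_def joined_def by blast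
  have inc: "ends C = ends G" "tail C = tail G" "head C = head G"
    and sets: "edges C \<subseteq> edges G" "arcs C \<subseteq> arcs G"
    using sub by (auto simp: submixed_def)
  have "submixed C (component_at G u)"
    using joined C.ends_in_verts C.tail_in_verts C.head_in_verts inc sets C.mixed_graph_axioms
    unfolding submixed_def component_at_def by (simp add: subset_iff)
  then have "component_at G u = C"
    using C saturated_component_at[OF G uG] connected_component_at[OF G uG]
    by (auto simp: component_def saturated_def)
  then show "saturated C G \<and> connected_mixed C"
    using saturated_component_at[OF G uG] con by simp
next
  assume C: "saturated C G \<and> connected_mixed C"
  then have sub: "submixed C G"
    by (simp add: saturated_def)
  then obtain u where u: "u \<in> verts C"
    by (auto simp: submixed_def mixed_graph_def)
  have "K = C" if K: "submixed K G" "connected_mixed K" "submixed C K" for K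
  proof -
    interpret K: mixed_graph K
      using K(1) by (simp add: submixed_def)
    have mC: "mixed_graph C"
      using sub by (simp add: submixed_def)
    have V: "verts K \<subseteq> verts C"
    proof
      fix v assume "v \<in> verts K"
      moreover have "u \<in> verts K"
        using K(3) u by (auto simp: submixed_def)
      ultimately obtain ss where "walk K u ss v"
        using K(2) unfolding connected_mixed_def by blast
      then have "walk G u ss v"
        by (rule walk_submixed[OF K(1)])
      then have "walk C u ss v"
        using C u by (blast intro: walk_in_saturated)
      then show "v \<in> verts C"
        by (rule walk_ends_in_verts[OF mC])
    qed
    have "edges K \<subseteq> edges C"
    proof
      fix e assume e: "e \<in> edges K"
      then have "set_uprod (ends G e) \<subseteq> verts C" "e \<in> edges G"
        using K.ends_in_verts V K(1) by (auto simp: submixed_def)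
      then show "e \<in> edges C"
        using C by (cases "ends G e") (auto simp: saturated_def)
    qed
    moreover have "arcs K \<subseteq> arcs C"
    proof
      fix a assume a: "a \<in> arcs K"
      then have "tail G a \<in> verts C" "a \<in> arcs G"
        using K.tail_in_verts V K(1) by (auto simp: submixed_def)
      then show "a \<in> arcs C"
        using C by (auto simp: saturated_def)
    qed
    ultimately have "submixed K C"
      using V K(1,3) by (auto simp: submixed_def)
    then show ?thesis
      using K(3) by (rule submixed_antisym)
  qed
  then show "component C G"
    using C sub by (simp add: component_def)
qed

lemma component_at_component:
  assumes "mixed_graph G" "u \<in> verts G"
  shows "component (component_at G u) G"
  using component_iff[OF assms(1)] saturated_component_at[OF assms] connected_component_at[OF assms]
  by blast

lemma ex_component:
  assumes "mixed_graph G" "u \<in> verts G"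
  obtains C where "component C G" "u \<in> verts C"
proof (rule that)
  show "component (component_at G u) G"
    using assms by (rule component_at_component)
  show "u \<in> verts (component_at G u)"
    using joined_refl[OF assms(2)] by (simp add: component_at_def)
qed

lemma component_verts_joined:
  assumes "mixed_graph G" "component C G" "u \<in> verts C" "joined G u v"
  shows "v \<in> verts C"
proof -
  have "saturated C G"
    using assms(2) component_iff[OF assms(1)] by blast
  moreover obtain ss where "walk G u ss v"
    using assms(4) by (auto simp: joined_def)
  ultimately have "walk C u ss v"
    using assms(3) by (rule walk_in_saturated)
  moreover have "mixed_graph C"
    using assms(2) by (simp add: component_def submixed_def)
  ultimately show ?thesis
    by (blast intro: walk_ends_in_verts)
qed

lemma component_unique:
  assumes G: "mixed_graph G" and C: "component C G" and D: "component D G"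
    and u: "u \<in> verts C" "u \<in> verts D"
  shows "C = D"
proof -
  have *: "submixed C D" if C: "component C G" and D: "component D G" and
      u: "u \<in> verts C" "u \<in> verts D" for C D
  proof -
    have s: "submixed C G" "submixed D G" and con: "connected_mixed C"
      using C D by (simp_all add: component_def)
    have D': "saturated D G"
      using D component_iff[OF G] by blast
    interpret C: mixed_graph C
      using s by (simp add: submixed_def)
    have V: "v \<in> verts D" if v: "v \<in> verts C" for v
    proof -
      obtain ss where "walk C u ss v"
        using v u(1) con unfolding connected_mixed_def by blast
      then have "joined G u v"
        using walk_submixed[OF s(1)] by (auto simp: joined_def)
      then show ?thesis
        by (rule component_verts_joined[OF G D u(2)])
    qed
    have "edges C \<subseteq> edges D"
    proof
      fix e assume e: "e \<in> edges C"
      then have "set_uprod (ends G e) \<subseteq> verts D" "e \<in> edges G"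
        using C.ends_in_verts V s(1) by (auto simp: submixed_def)
      then show "e \<in> edges D"
        using D' by (cases "ends G e") (auto simp: saturated_def)
    qed
    moreover have "arcs C \<subseteq> arcs D"
    proof
      fix a assume a: "a \<in> arcs C"
      then have "tail G a \<in> verts D" "a \<in> arcs G"
        using C.tail_in_verts V s(1) by (auto simp: submixed_def)
      then show "a \<in> arcs D"
        using D' by (auto simp: saturated_def)
    qed
    ultimately show ?thesis
      using V s by (auto simp: submixed_def)
  qed
  show ?thesis
    using *[OF C D u] *[OF D C u(2,1)] by (rule submixed_antisym)
qed


section \<open>Lifting walks to the associated graph and projecting them\<close>

text \<open>The sheet on which a walk in the associated graph is equals the direction in which it has to
  traverse its next arc: \<open>True\<close>, meaning forward, on the sheet of the vertices \<open>v'\<close>. The same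
  function describes the copies of edges.\<close>

definition copy :: "bool \<Rightarrow> 'x \<Rightarrow> 'x + 'x" where
  "copy s x = (if s then Inl x else Inr x)"

lemma copy_eq: "copy True = Inl" "copy False = Inr"
  by (simp_all add: copy_def fun_eq_iff)

lemma copy_inject [simp]: "copy s x = copy t y \<longleftrightarrow> s = t \<and> x = y"
  by (auto simp: copy_def)

lemma copy_exhaust: obtains s x where "z = copy s x"
  by (cases z) (metis copy_eq)+

lemma copy_mem_Plus [simp]: "copy s x \<in> A <+> A \<longleftrightarrow> x \<in> A"
  by (auto simp: copy_def)

lemma Inl_mem_Plus [simp]: "Inl x \<in> A <+> B \<longleftrightarrow> x \<in> A"
  and Inr_mem_Plus [simp]: "Inr y \<in> A <+> B \<longleftrightarrow> y \<in> B"
  by auto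

lemma associated_simps [simp]:
  "verts (associated_graph G) = verts G <+> verts G"
  "edges (associated_graph G) = (edges G <+> edges G) <+> arcs G"
  "arcs (associated_graph G) = {}"
  "ends (associated_graph G) (Inl (copy s e)) = map_uprod (copy s) (ends G e)"
  "ends (associated_graph G) (Inr a) = Upair (copy True (tail G a)) (copy False (head G a))"
proof -
  show "ends (associated_graph G) (Inl (copy s e)) = map_uprod (copy s) (ends G e)"
    by (cases s) (simp_all add: associated_graph_def copy_eq)
qed (auto simp: associated_graph_def copy_def)

lemma associated_edge_cases:
  obtains (edge) s e where "x = Inl (copy s e)" | (arc) a where "x = Inr a"
  by (metis copy_exhaust sum.exhaust)

lemma mixed_graph_associated:
  assumes "mixed_graph G"
  shows "mixed_graph (associated_graph G)"
proof -
  interpret mixed_graph G by fact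
  have "set_uprod (ends (associated_graph G) x) \<subseteq> verts (associated_graph G)"
    if x: "x \<in> edges (associated_graph G)" for x
  proof (cases x rule: associated_edge_cases)
    case (edge s e)
    then have "e \<in> edges G" using x by simp
    then show ?thesis
      using edge ends_in_verts[of e] by (cases "ends G e") auto
  next
    case (arc a)
    then have "a \<in> arcs G" using x by simp
    then show ?thesis
      using arc tail_in_verts head_in_verts by auto
  qed
  then show ?thesis
    using finite_verts verts_nonempty finite_edges finite_arcs
    by (auto simp: mixed_graph_def)
qed

text \<open>This is alternation together with a prescribed first direction. In contrast to alternation
  alone, it says what is needed for a concatenation (\<open>switching_append\<close>): the second walk has to
  continue on the sheet on which the first one ends.\<close>

fun switching :: "bool \<Rightarrow> bool list \<Rightarrow> bool" where
  "switching s [] \<longleftrightarrow> True"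
| "switching s (d # ds) \<longleftrightarrow> d = s \<and> switching (\<not> s) ds"

lemma switching_iff: "switching s ds \<longleftrightarrow> distinct_adj ds \<and> (ds \<noteq> [] \<longrightarrow> hd ds = s)"
  by (induction ds arbitrary: s) (auto simp: distinct_adj_Cons)

lemma switching_append:
  "switching s (ds @ ds') \<longleftrightarrow> switching s ds \<and> switching (s = even (length ds)) ds'"
proof (induction ds arbitrary: s)
  case (Cons d ds)
  have "((\<not> s) = even (length ds)) = (s = even (length (d # ds)))"
    by (cases s; cases "even (length ds)") simp_all
  then show ?case
    using Cons[of "\<not> s"] by simp
qed simp

lemma switching_reverse:
  "switching s ds \<Longrightarrow> switching (s = even (length ds)) (map Not (rev ds))"
proof (induction ds arbitrary: s)
  case (Cons d ds)
  then have "switching ((\<not> s) = even (length ds)) (map Not (rev ds))"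
    by simp
  then show ?case
    using Cons.prems by (cases s; cases "even (length ds)") (auto simp: switching_append)
qed simp

lemma alternating_switching:
  "alternating ss \<longleftrightarrow> arc_directions ss \<noteq> [] \<and> (\<exists>s. switching s (arc_directions ss))"
  by (auto simp: alternating_def switching_iff)

lemma arc_directions_append [simp]:
  "arc_directions (ss @ ts) = arc_directions ss @ arc_directions ts"
  by (induction ss rule: arc_directions.induct) auto

lemma arc_directions_reverse:
  "arc_directions (rev (map reverse_step ss)) = map Not (rev (arc_directions ss))"
  by (induction ss rule: arc_directions.induct) auto

text \<open>The copy of an arc can be entered on sheet \<open>s\<close> only in direction \<open>s\<close>, and it leads to the other
  sheet. So a walk lifts if each direction is the sheet reached so far, and the parity of the
  number of arcs tells on which sheet the lift ends.\<close>

lemma walk_lift: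
  assumes G: "mixed_graph G" and K: "submixed K G"
    and "walk K u ss v" "switching s (arc_directions ss)"
  shows "joined (associated_graph G) (copy s u) (copy (s = even (num_arcs ss)) v)"
  using assms(3,4)
proof (induction arbitrary: s)
  case (Nil u)
  then show ?case
    using K by (auto simp: num_arcs_def submixed_def intro!: joined_refl)
next
  case (Along e u v ss w)
  have "e \<in> edges G" "ends G e = Upair u v"
    using Along K by (auto simp: submixed_def)
  then have "joined (associated_graph G) (copy s u) (copy s v)"
    using joined_edge[OF mixed_graph_associated[OF G], of "Inl (copy s e)"] by simp
  then show ?case
    using Along by (auto simp: num_arcs_def intro: joined_trans)
next
  case (Forward a ss w)
  have "a \<in> arcs G" "tail K = tail G" "head K = head G"
    using Forward K by (auto simp: submixed_def)
  then have "joined (associated_graph G) (copy True (tail K a)) (copy False (head K a))"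
    using joined_edge[OF mixed_graph_associated[OF G], of "Inr a"] by simp
  moreover have "joined (associated_graph G) (copy False (head K a))
      (copy (False = even (num_arcs ss)) w)"
    using Forward.IH[of False] Forward.prems by auto
  ultimately have "joined (associated_graph G) (copy True (tail K a))
      (copy (False = even (num_arcs ss)) w)"
    by (rule joined_trans)
  then show ?case
    using Forward.prems by (auto simp: num_arcs_def)
next
  case (Backward a ss w)
  have "a \<in> arcs G" "tail K = tail G" "head K = head G"
    using Backward K by (auto simp: submixed_def)
  then have "joined (associated_graph G) (copy False (head K a)) (copy True (tail K a))"
    using joined_edge[OF mixed_graph_associated[OF G], of "Inr a"] by simp
  moreover have "joined (associated_graph G) (copy True (tail K a))
      (copy (True = even (num_arcs ss)) w)"
    using Backward.IH[of True] Backward.prems by auto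
  ultimately have "joined (associated_graph G) (copy False (head K a))
      (copy (True = even (num_arcs ss)) w)"
    by (rule joined_trans)
  then show ?case
    using Backward.prems by (auto simp: num_arcs_def)
qed

text \<open>This is the image in \<open>G\<close> of a submixed graph \<open>C\<close> of the associated graph. Type III components
  will turn out to be the shadows with arcs.\<close>

definition shadow ::
    "('v, 'e, 'a) pre_mixed_graph \<Rightarrow> ('v + 'v, ('e + 'e) + 'a, 'a) pre_mixed_graph
      \<Rightarrow> ('v, 'e, 'a) pre_mixed_graph" where
  "shadow G C = G\<lparr>verts := {v. \<exists>s. copy s v \<in> verts C},
     edges := {e. \<exists>s. Inl (copy s e) \<in> edges C},
     arcs := {a. Inr a \<in> edges C}\<rparr>"

lemma shadow_simps [simp]:
  "verts (shadow G C) = {v. \<exists>s. copy s v \<in> verts C}"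
  "edges (shadow G C) = {e. \<exists>s. Inl (copy s e) \<in> edges C}"
  "arcs (shadow G C) = {a. Inr a \<in> edges C}"
  "ends (shadow G C) = ends G" "tail (shadow G C) = tail G" "head (shadow G C) = head G"
  by (simp_all add: shadow_def)

lemma arc_copies_in_verts:
  assumes "submixed C (associated_graph G)" "Inr a \<in> edges C"
  shows "copy True (tail G a) \<in> verts C" "copy False (head G a) \<in> verts C"
  using mixed_graph.ends_in_verts[of C "Inr a"] assms by (auto simp: submixed_def)

lemma edge_copies_in_verts:
  assumes "submixed C (associated_graph G)" "Inl (copy s e) \<in> edges C" "v \<in> set_uprod (ends G e)"
  shows "copy s v \<in> verts C"
  using mixed_graph.ends_in_verts[of C "Inl (copy s e)"] assms
  by (cases "ends G e") (auto simp: submixed_def)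

lemma submixed_shadow:
  assumes G: "mixed_graph G" and C: "submixed C (associated_graph G)"
  shows "submixed (shadow G C) G"
proof -
  interpret mixed_graph G by fact
  have sets: "verts C \<subseteq> verts G <+> verts G" "edges C \<subseteq> (edges G <+> edges G) <+> arcs G"
    using C by (auto simp: submixed_def)
  have sub: "verts (shadow G C) \<subseteq> verts G" "edges (shadow G C) \<subseteq> edges G"
      "arcs (shadow G C) \<subseteq> arcs G"
    using sets by (auto simp: copy_def split: if_splits)
  obtain z where "z \<in> verts C"
    using C by (auto simp: submixed_def mixed_graph_def)
  then have "verts (shadow G C) \<noteq> {}"
    by (cases z rule: copy_exhaust) auto
  moreover have "\<exists>s. copy s (tail G a) \<in> verts C" "\<exists>s. copy s (head G a) \<in> verts C"
    if "Inr a \<in> edges C" for a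
    using arc_copies_in_verts[OF C that] by blast+
  moreover have "\<exists>s. copy s v \<in> verts C"
    if "Inl (copy t e) \<in> edges C" "v \<in> set_uprod (ends G e)" for t e v
    using edge_copies_in_verts[OF C that] by blast
  ultimately have "mixed_graph (shadow G C)"
    using finite_subset[OF sub(1) finite_verts] finite_subset[OF sub(2) finite_edges]
      finite_subset[OF sub(3) finite_arcs]
    unfolding mixed_graph_def by auto
  then show ?thesis
    using sub by (simp add: submixed_def)
qed

text \<open>Conversely, the copy of an arc is read as a forward step when it is entered on the upper sheet
  and as a backward step when it is entered on the lower one, and copies of edges keep the sheet.
  The projected walk uses nothing outside the shadow.\<close>

lemma walk_project:
  assumes C: "submixed C (associated_graph G)" and "walk C (copy s u) ts y"
  obtains ss v where "y = copy (s = even (num_arcs ss)) v" "walk (shadow G C) u ss v"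
    "switching s (arc_directions ss)"
proof -
  have sub: "ends C = ends (associated_graph G)" "arcs C = {}"
    using C by (auto simp: submixed_def)
  have "\<exists>ss v. y = copy (s = even (num_arcs ss)) v \<and> walk (shadow G C) u ss v \<and>
      switching s (arc_directions ss)" if "walk C x ts y" "x = copy s u" for x s u
    using that
  proof (induction arbitrary: s u)
    case (Nil x)
    then show ?case
      by (intro exI[of _ "[]"]) (auto simp: num_arcs_def intro!: walk.Nil)
  next
    case (Along x y z ts w)
    show ?case
    proof (cases x rule: associated_edge_cases)
      case (edge t e)
      then have "map_uprod (copy t) (ends G e) = Upair (copy s u) z"
        using Along sub by simp
      then obtain u' where t: "t = s" and z: "z = copy s u'" and e: "ends G e = Upair u u'"
        by (cases "ends G e") auto
      obtain ss v where ss: "w = copy (s = even (num_arcs ss)) v" "walk (shadow G C) u' ss v"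
          "switching s (arc_directions ss)"
        using Along.IH[OF z] by blast
      have "e \<in> edges (shadow G C)" "ends (shadow G C) e = Upair u u'"
        using Along.hyps edge e by auto
      then have "walk (shadow G C) u (Along e # ss) v"
        using ss(2) by (rule walk.Along)
      then show ?thesis
        using ss by (intro exI[of _ "Along e # ss"]) (auto simp: num_arcs_def)
    next
      case (arc a)
      have a: "a \<in> arcs (shadow G C)"
        using Along.hyps arc by auto
      have "Upair (copy True (tail G a)) (copy False (head G a)) = Upair (copy s u) z"
        using Along.hyps Along.prems arc sub by simp
      then consider "s" "u = tail G a" "z = copy False (head G a)"
        | "\<not> s" "u = head G a" "z = copy True (tail G a)"
        by auto
      then show ?thesis
      proof cases
        case 1
        obtain ss v where ss: "w = copy (False = even (num_arcs ss)) v"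
            "walk (shadow G C) (head G a) ss v" "switching False (arc_directions ss)"
          using Along.IH[OF 1(3)] by blast
        have "walk (shadow G C) u (Forward a # ss) v"
          using walk.Forward[OF a] ss 1 by simp
        then show ?thesis
          using ss 1 by (intro exI[of _ "Forward a # ss"]) (auto simp: num_arcs_def)
      next
        case 2
        obtain ss v where ss: "w = copy (True = even (num_arcs ss)) v"
            "walk (shadow G C) (tail G a) ss v" "switching True (arc_directions ss)"
          using Along.IH[OF 2(3)] by blast
        have "walk (shadow G C) u (Backward a # ss) v"
          using walk.Backward[OF a] ss 2 by simp
        then show ?thesis
          using ss 2 by (intro exI[of _ "Backward a # ss"]) (auto simp: num_arcs_def)
      qed
    qed
  next
    case (Forward a ss w)
    then show ?case using sub by simp
  next
    case (Backward a ss w)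
    then show ?case using sub by simp
  qed
  then show ?thesis
    using assms(2) that by blast
qed

lemma saturated_component:
  "mixed_graph G \<Longrightarrow> component C (associated_graph G) \<Longrightarrow> saturated C (associated_graph G)"
  using component_iff[OF mixed_graph_associated] by blast

lemma component_edge_copy:
  assumes G: "mixed_graph G" and C: "component C (associated_graph G)"
    and e: "e \<in> edges G" "v \<in> set_uprod (ends G e)" "copy s v \<in> verts C"
  shows "Inl (copy s e) \<in> edges C"
proof (rule saturated_edge[OF saturated_component[OF G C] _ _ e(3)])
  show "Inl (copy s e) \<in> edges (associated_graph G)"
    using e by simp
  show "copy s v \<in> set_uprod (ends (associated_graph G) (Inl (copy s e)))"
    using e by (cases "ends G e") auto
qed

lemma component_arc_copy:
  assumes G: "mixed_graph G" and C: "component C (associated_graph G)"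
    and a: "a \<in> arcs G" "copy True (tail G a) \<in> verts C"
  shows "Inr a \<in> edges C"
proof (rule saturated_edge[OF saturated_component[OF G C] _ _ a(2)])
  show "Inr a \<in> edges (associated_graph G)"
    using a by simp
qed simp

lemma component_joined_copy:
  assumes "mixed_graph G" "component C (associated_graph G)"
    and "x \<in> verts C" "joined (associated_graph G) x y"
  shows "y \<in> verts C"
  using component_verts_joined[OF mixed_graph_associated[OF assms(1)] assms(2-4)] .

lemma component_submixed: "component C G \<Longrightarrow> submixed C G"
  by (simp add: component_def)

lemma component_walk:
  assumes "component C G" "u \<in> verts C" "v \<in> verts C"
  obtains ss where "walk C u ss v"
  using assms unfolding component_def connected_mixed_def by blast

lemma undirected_part_simps [simp]:
  "verts (undirected_part G) = verts G" "edges (undirected_part G) = edges G"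
  "arcs (undirected_part G) = {}" "ends (undirected_part G) = ends G"
  "tail (undirected_part G) = tail G" "head (undirected_part G) = head G"
  by (simp_all add: undirected_part_def)

lemma mixed_graph_undirected_part: "mixed_graph G \<Longrightarrow> mixed_graph (undirected_part G)"
  by (simp add: mixed_graph_def)

lemma submixed_undirected_part_iff:
  "submixed H (undirected_part G) \<longleftrightarrow> submixed H G \<and> arcs H = {}"
  by (auto simp: submixed_def)

lemma arc_directions_no_arcs: "walk G u ss v \<Longrightarrow> arcs G = {} \<Longrightarrow> arc_directions ss = []"
  by (induction rule: walk.induct) auto


section \<open>Components on one sheet\<close>

definition sheet ::
    "('v, 'e, 'a) pre_mixed_graph \<Rightarrow> bool \<Rightarrow> ('v, 'e, 'a) pre_mixed_graph
      \<Rightarrow> ('v + 'v, ('e + 'e) + 'a, 'a) pre_mixed_graph" where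
  "sheet G s H = (associated_graph G)\<lparr>verts := copy s ` verts H,
     edges := (\<lambda>e. Inl (copy s e)) ` edges H\<rparr>"

text \<open>The end of an arc whose copy on the given sheet is an end of the arc's edge in the associated
  graph.\<close>

definition foot :: "('v, 'e, 'a) pre_mixed_graph \<Rightarrow> bool \<Rightarrow> 'a \<Rightarrow> 'v" where
  "foot G s a = (if s then tail G a else head G a)"

lemma sheet_simps [simp]:
  "verts (sheet G s H) = copy s ` verts H"
  "edges (sheet G s H) = (\<lambda>e. Inl (copy s e)) ` edges H"
  "arcs (sheet G s H) = {}"
  "ends (sheet G s H) = ends (associated_graph G)"
  "tail (sheet G s H) = tail (associated_graph G)"
  "head (sheet G s H) = head (associated_graph G)"
  by (simp_all add: sheet_def)

lemma copy_mem_image [simp]: "copy s x \<in> copy t ` A \<longleftrightarrow> s = t \<and> x \<in> A"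
  by auto

lemma shadow_sheet:
  assumes "submixed H G" "arcs H = {}"
  shows "shadow G (sheet G s H) = H"
  using assms by (intro pre_mixed_graph.equality) (auto simp: submixed_def)

lemma submixed_sheet:
  assumes G: "mixed_graph G" and H: "submixed H G"
  shows "submixed (sheet G s H) (associated_graph G)"
proof -
  interpret H: mixed_graph H
    using H by (simp add: submixed_def)
  have inc: "ends H = ends G" "verts H \<subseteq> verts G" "edges H \<subseteq> edges G"
    using H by (auto simp: submixed_def)
  have "x \<in> copy s ` verts H"
    if "e \<in> edges H" "x \<in> set_uprod (map_uprod (copy s) (ends G e))" for e x
    using H.ends_in_verts[OF that(1)] that(2) inc by (cases "ends G e") auto
  then have "mixed_graph (sheet G s H)"
    using H.finite_verts H.finite_edges H.verts_nonempty unfolding mixed_graph_def by auto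
  then show ?thesis
    using inc by (auto simp: submixed_def)
qed

text \<open>The copy of \<open>H\<close> on a sheet can only fail to be closed under incidence because of an edge that
  \<open>H\<close> lacks in \<open>G\<^sub>u\<close> or because of an arc with its foot in \<open>H\<close>.\<close>

lemma saturated_sheet_iff:
  fixes G :: "('v, 'e, 'a) pre_mixed_graph"
  assumes G: "mixed_graph G" and H: "submixed H G" "arcs H = {}"
  shows "saturated (sheet G s H) (associated_graph G) \<longleftrightarrow>
    saturated H (undirected_part G) \<and> (\<forall>a\<in>arcs G. foot G s a \<notin> verts H)"
proof -
  have touch: "set_uprod (ends (associated_graph G) (Inl (copy t e))) \<inter> copy s ` verts H \<noteq> {} \<longleftrightarrow>
      t = s \<and> set_uprod (ends G e) \<inter> verts H \<noteq> {}" for t e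
    by (cases "ends G e") auto
  have touch_arc: "set_uprod (ends (associated_graph G) (Inr a)) \<inter> copy s ` verts H \<noteq> {} \<longleftrightarrow>
      foot G s a \<in> verts H" for a
    by (cases s) (auto simp: foot_def)
  have edge: "Inl (copy t e) \<in> (\<lambda>e. Inl (copy s e)) ` edges H \<longleftrightarrow> t = s \<and> e \<in> edges H"
    and no_arc: "Inr a \<notin> (\<lambda>e. Inl (copy s e)) ` edges H" for t e and a :: 'a
    by auto
  have only_s: "(\<forall>t. \<forall>e\<in>E. t = s \<and> P e \<longrightarrow> t = s \<and> Q e) \<longleftrightarrow> (\<forall>e\<in>E. P e \<longrightarrow> Q e)"
    for E :: "'e set" and P Q
    by auto
  have split: "(\<forall>x\<in>edges (associated_graph G). P x) \<longleftrightarrow>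
      (\<forall>t. \<forall>e\<in>edges G. P (Inl (copy t e))) \<and> (\<forall>a\<in>arcs G. P (Inr a))" for P
  proof (intro iffI conjI allI ballI)
    fix x
    assume P: "(\<forall>t. \<forall>e\<in>edges G. P (Inl (copy t e))) \<and> (\<forall>a\<in>arcs G. P (Inr a))"
      and x: "x \<in> edges (associated_graph G)"
    show "P x"
      using P x by (cases x rule: associated_edge_cases) simp_all
  qed simp_all
  show ?thesis
    using submixed_sheet[OF G H(1), of s] H no_arc
    unfolding saturated_def split sheet_simps touch touch_arc edge only_s
      submixed_undirected_part_iff undirected_part_simps associated_simps(3)
    by simp
qed

lemma connected_sheet_iff:
  assumes G: "mixed_graph G" and H: "submixed H G" "arcs H = {}"
    and sat: "saturated (sheet G s H) (associated_graph G)"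
  shows "connected_mixed (sheet G s H) \<longleftrightarrow> connected_mixed H"
proof
  assume con: "connected_mixed (sheet G s H)"
  have "\<exists>ss. walk H u ss v" if "u \<in> verts H" "v \<in> verts H" for u v
  proof -
    obtain ts where "walk (sheet G s H) (copy s u) ts (copy s v)"
      using con \<open>u \<in> verts H\<close> \<open>v \<in> verts H\<close> by (auto simp: connected_mixed_def)
    then obtain ss v' where "copy s v = copy (s = even (num_arcs ss)) v'"
        "walk (shadow G (sheet G s H)) u ss v'"
      by (rule walk_project[OF submixed_sheet[OF G H(1)]])
    then show ?thesis
      by (auto simp: shadow_sheet[OF H])
  qed
  then show "connected_mixed H"
    by (simp add: connected_mixed_def)
next
  assume con: "connected_mixed H"
  have "\<exists>ts. walk (sheet G s H) (copy s u) ts (copy s v)"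
    if "u \<in> verts H" "v \<in> verts H" for u v
  proof -
    obtain ss where ss: "walk H u ss v"
      using con \<open>u \<in> verts H\<close> \<open>v \<in> verts H\<close> by (auto simp: connected_mixed_def)
    have "arc_directions ss = []"
      using ss H(2) by (rule arc_directions_no_arcs)
    then have "joined (associated_graph G) (copy s u) (copy s v)"
      using walk_lift[OF G H(1) ss, of s] by (simp add: num_arcs_def)
    then obtain ts where "walk (associated_graph G) (copy s u) ts (copy s v)"
      by (auto simp: joined_def)
    moreover have "copy s u \<in> verts (sheet G s H)"
      using \<open>u \<in> verts H\<close> by simp
    ultimately show ?thesis
      using walk_in_saturated[OF sat] by blast
  qed
  then show "connected_mixed (sheet G s H)"
    by (auto simp: connected_mixed_def)
qed

lemma component_sheet_iff:
  assumes G: "mixed_graph G" and H: "submixed H G" "arcs H = {}"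
  shows "component (sheet G s H) (associated_graph G) \<longleftrightarrow>
    component H (undirected_part G) \<and> (\<forall>a\<in>arcs G. foot G s a \<notin> verts H)"
  using saturated_sheet_iff[OF assms] connected_sheet_iff[OF assms]
    component_iff[OF mixed_graph_associated[OF G]] component_iff[OF mixed_graph_undirected_part[OF G]]
  by blast

text \<open>Only the copies of arcs connect the two sheets.\<close>

lemma component_without_arcs_is_sheet:
  assumes G: "mixed_graph G" and C: "component C (associated_graph G)"
    and no_arcs: "arcs (shadow G C) = {}"
  obtains s where "C = sheet G s (shadow G C)"
proof -
  have sub: "submixed C (associated_graph G)"
    using C by (rule component_submixed)
  then obtain z where "z \<in> verts C"
    by (auto simp: submixed_def mixed_graph_def)
  then obtain s u where u: "copy s u \<in> verts C"
    by (metis copy_exhaust)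
  have same: "t = s" if v: "copy t v \<in> verts C" for t v
  proof -
    obtain ts where "walk C (copy s u) ts (copy t v)"
      using component_walk[OF C u v] .
    then obtain ss v' where ss: "copy t v = copy (s = even (num_arcs ss)) v'"
        "walk (shadow G C) u ss v'"
      by (rule walk_project[OF sub])
    have "arc_directions ss = []"
      using ss(2) no_arcs by (rule arc_directions_no_arcs)
    then show ?thesis
      using ss(1) by (auto simp: num_arcs_def)
  qed
  have V: "verts C = copy s ` verts (shadow G C)"
  proof (intro equalityI subsetI)
    fix z assume "z \<in> verts C"
    then show "z \<in> copy s ` verts (shadow G C)"
      using same by (cases z rule: copy_exhaust) auto
  next
    fix z assume "z \<in> copy s ` verts (shadow G C)"
    then show "z \<in> verts C"
      using same by auto
  qed
  have same_edge: "t = s" if "Inl (copy t e) \<in> edges C" for t e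
  proof -
    obtain p q where "ends G e = Upair p q"
      by (cases "ends G e")
    then show ?thesis
      using same edge_copies_in_verts[OF sub that, of p] by auto
  qed
  have "edges C = (\<lambda>e. Inl (copy s e)) ` edges (shadow G C)"
  proof (rule equalityI)
    show "edges C \<subseteq> (\<lambda>e. Inl (copy s e)) ` edges (shadow G C)"
    proof
      fix x assume "x \<in> edges C"
      then show "x \<in> (\<lambda>e. Inl (copy s e)) ` edges (shadow G C)"
        using same_edge no_arcs by (cases x rule: associated_edge_cases) auto
    qed
    show "(\<lambda>e. Inl (copy s e)) ` edges (shadow G C) \<subseteq> edges C"
      using same_edge by auto
  qed
  then have "C = sheet G s (shadow G C)"
    using V sub by (intro pre_mixed_graph.equality) (auto simp: submixed_def)
  then show ?thesis
    by (rule that)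
qed

lemma type_I_iff:
  assumes "mixed_graph G"
  shows "type_I H G \<longleftrightarrow>
    component H (undirected_part G) \<and> (\<forall>a\<in>arcs G. foot G True a \<notin> verts H)"
  using mixed_graph.finite_arcs[OF assms] by (auto simp: type_I_def out_degree_def foot_def)

lemma type_II_iff:
  assumes "mixed_graph G"
  shows "type_II H G \<longleftrightarrow>
    component H (undirected_part G) \<and> (\<forall>a\<in>arcs G. foot G False a \<notin> verts H)"
  using mixed_graph.finite_arcs[OF assms] by (auto simp: type_II_def in_degree_def foot_def)

text \<open>If no arc starts or ends in \<open>H\<close>, being closed under incidence means the same in \<open>G\<close> and in
  \<open>G\<^sub>u\<close>.\<close>

lemma type_I_and_II_iff:
  assumes G: "mixed_graph G"
  shows "type_I H G \<and> type_II H G \<longleftrightarrow> component H G \<and> arcs H = {}"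
proof -
  have "(\<forall>a\<in>arcs G. foot G True a \<notin> verts H) \<and> (\<forall>a\<in>arcs G. foot G False a \<notin> verts H) \<longleftrightarrow>
      (\<forall>a\<in>arcs G. tail G a \<in> verts H \<or> head G a \<in> verts H \<longrightarrow> a \<in> arcs H)" if "arcs H = {}"
    using that by (auto simp: foot_def)
  then show ?thesis
    unfolding type_I_iff[OF G] type_II_iff[OF G] component_iff[OF G]
      component_iff[OF mixed_graph_undirected_part[OF G]] saturated_def
      submixed_undirected_part_iff undirected_part_simps
    by (cases "arcs H = {}", simp, argo, simp)
qed


section \<open>Components containing arcs\<close>

text \<open>Walks in \<open>C\<close> project to switching walks in the shadow. Making such a walk pass through the copy
  of some arc ensures that it has an arc, which alternation demands. For condition (ii), the
  arc starting in \<open>H\<close> and the one ending in \<open>H\<close> put vertices of both sheets into \<open>C\<close>, so \<open>C\<close> contains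
  both copies of each vertex of \<open>H\<close>, and a walk between them has an odd number of arcs.\<close>

lemma special_shadow:
  assumes G: "mixed_graph G" and C: "component C (associated_graph G)"
    and arcs: "arcs (shadow G C) \<noteq> {}"
  shows "special (shadow G C) G"
proof -
  have sub: "submixed C (associated_graph G)"
    using C by (rule component_submixed)
  have subS: "submixed (shadow G C) G"
    using G sub by (rule submixed_shadow)
  have walk_of: "\<exists>ss. walk (shadow G C) u ss v \<and> switching s (arc_directions ss) \<and>
      t = (s = even (num_arcs ss))" if uv: "copy s u \<in> verts C" "copy t v \<in> verts C" for s u t v
  proof -
    obtain ts where "walk C (copy s u) ts (copy t v)"
      using component_walk[OF C uv] .
    then show ?thesis
      by (rule walk_project[OF sub]) auto
  qed
  have alt: "\<exists>ss. walk (shadow G C) u ss v \<and> alternating ss"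
    if uv: "u \<in> verts (shadow G C)" "v \<in> verts (shadow G C)" for u v
  proof -
    obtain s t where st: "copy s u \<in> verts C" "copy t v \<in> verts C"
      using uv by auto
    obtain a where a: "a \<in> arcs (shadow G C)"
      using arcs by blast
    then have ends: "copy True (tail G a) \<in> verts C" "copy False (head G a) \<in> verts C"
      using arc_copies_in_verts[OF sub] by auto
    obtain ss1 where ss1: "walk (shadow G C) u ss1 (tail G a)"
        "switching s (arc_directions ss1)" "True = (s = even (num_arcs ss1))"
      using walk_of[OF st(1) ends(1)] by blast
    obtain ss2 where ss2: "walk (shadow G C) (head G a) ss2 v"
        "switching False (arc_directions ss2)"
      using walk_of[OF ends(2) st(2)] by blast
    have "walk (shadow G C) (tail G a) (Forward a # ss2) v"
      using walk.Forward[OF a] ss2(1) by simp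
    with ss1(1) have "walk (shadow G C) u (ss1 @ Forward a # ss2) v"
      by (rule walk_append)
    moreover have "switching s (arc_directions (ss1 @ Forward a # ss2))"
      using ss1 ss2 by (auto simp: switching_append num_arcs_def)
    then have "alternating (ss1 @ Forward a # ss2)"
      unfolding alternating_switching by auto
    ultimately show ?thesis
      by blast
  qed
  have odd: "\<exists>ss. walk (shadow G C) v ss v \<and> alternating ss \<and> odd (num_arcs ss)"
    if H: "component H (undirected_part (shadow G C))"
      and a: "a \<in> arcs (shadow G C)" "head G a \<in> verts H"
      and b: "b \<in> arcs (shadow G C)" "tail G b \<in> verts H"
      and v: "v \<in> verts H" for H a b v
  proof -
    have HG: "submixed H G" "arcs H = {}"
      using component_submixed[OF H] submixed_trans[OF _ subS]
      by (auto simp: submixed_undirected_part_iff)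
    \<comment> \<open>As \<open>H\<close> has no arcs, its walks lift to either sheet and stay on it.\<close>
    have copies: "copy s v \<in> verts C" if u: "u \<in> verts H" "copy s u \<in> verts C" for s u
    proof -
      obtain ss where ss: "walk H u ss v"
        using component_walk[OF H u(1) v] .
      have "arc_directions ss = []"
        using ss HG(2) by (rule arc_directions_no_arcs)
      then have "joined (associated_graph G) (copy s u) (copy s v)"
        using walk_lift[OF G HG(1) ss, of s] by (simp add: num_arcs_def)
      then show ?thesis
        by (rule component_joined_copy[OF G C u(2)])
    qed
    have "copy True v \<in> verts C"
      using copies[OF b(2)] arc_copies_in_verts[OF sub] b(1) by simp
    moreover have "copy False v \<in> verts C"
      using copies[OF a(2)] arc_copies_in_verts[OF sub] a(1) by simp
    ultimately obtain ss where ss: "walk (shadow G C) v ss v" "switching True (arc_directions ss)"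
        "False = (True = even (num_arcs ss))"
      using walk_of by blast
    then have "alternating ss"
      by (auto simp: alternating_switching num_arcs_def)
    then show ?thesis
      using ss by auto
  qed
  show ?thesis
    unfolding special_def
  proof (intro conjI ballI allI impI)
    fix H v
    assume "component H (undirected_part (shadow G C)) \<and>
      (\<exists>a\<in>arcs (shadow G C). head (shadow G C) a \<in> verts H) \<and>
      (\<exists>a\<in>arcs (shadow G C). tail (shadow G C) a \<in> verts H)" "v \<in> verts H"
    then show "\<exists>ss. walk (shadow G C) v ss v \<and> alternating ss \<and> odd (num_arcs ss)"
      using odd by (metis shadow_simps(5,6))
  next
    fix u v
    assume "u \<in> verts (shadow G C)" "v \<in> verts (shadow G C)"
    then show "\<exists>ss. walk (shadow G C) u ss v \<and> alternating ss"
      by (rule alt)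
  next
    show "submixed (shadow G C) G"
      by (rule subS)
    show "arcs (shadow G C) \<noteq> {}"
      by (rule arcs)
  qed
qed

text \<open>Up to its first arc, a walk stays in one undirected component, and a backward arc is entered
  at its head.\<close>

lemma first_backward_arc:
  assumes K: "mixed_graph K"
    and "walk K w ss v" "switching False (arc_directions ss)" "arc_directions ss \<noteq> []"
  shows "\<exists>c\<in>arcs K. joined (undirected_part K) w (head K c)"
  using assms(2-4)
proof induction
  case (Along e u v ss w)
  then obtain c where c: "c \<in> arcs K" "joined (undirected_part K) v (head K c)"
    by auto
  have "joined (undirected_part K) u v"
    using joined_edge[OF mixed_graph_undirected_part[OF K], of e u v] Along by simp
  then show ?case
    using c joined_trans by metis
next
  case (Backward a ss w)
  then have "joined (undirected_part K) (head K a) (head K a)"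
    using mixed_graph.head_in_verts[OF K] by (intro joined_refl) simp
  then show ?case
    using Backward.hyps by blast
qed auto

text \<open>This is where condition (ii) enters. At a vertex where an arc starts, an alternating walk that
  begins with a backward arc shows that the undirected component also has a vertex where an arc
  ends. The odd closed alternating walk then connects the two copies of the vertex.\<close>

lemma special_copies_joined:
  assumes G: "mixed_graph G" and K: "special K G" and b: "b \<in> arcs K"
    and w: "walk K (tail G b) ss v" "switching False (arc_directions ss)" "arc_directions ss \<noteq> []"
  shows "joined (associated_graph G) (copy True (tail G b)) (copy False (tail G b))"
proof -
  have KG: "submixed K G"
    using K by (simp add: special_def)
  then have mK: "mixed_graph K" and inc: "tail K = tail G" "head K = head G"
    by (auto simp: submixed_def)
  obtain c where c: "c \<in> arcs K" "joined (undirected_part K) (tail G b) (head K c)"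
    using first_backward_arc[OF mK w] by blast
  have "tail G b \<in> verts K"
    using mixed_graph.tail_in_verts[OF mK b] inc by simp
  then obtain H where H: "component H (undirected_part K)" "tail G b \<in> verts H"
    using ex_component[OF mixed_graph_undirected_part[OF mK]] by auto
  have "head K c \<in> verts H"
    using component_verts_joined[OF mixed_graph_undirected_part[OF mK] H c(2)] .
  then obtain p where p: "walk K (tail G b) p (tail G b)" "alternating p" "odd (num_arcs p)"
    using K H b c(1) inc unfolding special_def by metis
  then obtain s where "switching s (arc_directions p)"
    by (auto simp: alternating_switching)
  then have "joined (associated_graph G) (copy s (tail G b)) (copy (\<not> s) (tail G b))"
    using walk_lift[OF G KG p(1), of s] p(3) by simp
  then show ?thesis
    using joined_sym[OF mixed_graph_associated[OF G]] by (cases s) auto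
qed

text \<open>An alternating walk from the tail of \<open>a\<close> to \<open>v\<close> lifts to a walk in the associated graph, but
  possibly one that starts or ends on the wrong sheet. The sheet is switched at the start directly
  by the preceding lemma and, if an arc starts at \<open>v\<close>, at the end by applying it to the reversed
  walk.\<close>

lemma special_subset_shadow:
  assumes G: "mixed_graph G" and K: "special K G"
  obtains C where "component C (associated_graph G)" "submixed K (shadow G C)"
proof -
  note AG = mixed_graph_associated[OF G]
  have KG: "submixed K G"
    using K by (simp add: special_def)
  then have mK: "mixed_graph K" and inc: "ends K = ends G" "tail K = tail G" "head K = head G"
    and sets: "verts K \<subseteq> verts G" "edges K \<subseteq> edges G" "arcs K \<subseteq> arcs G"
    by (auto simp: submixed_def)
  interpret K: mixed_graph K
    by fact
  obtain a where a: "a \<in> arcs K"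
    using K by (auto simp: special_def)
  define u where "u = tail G a"
  have u: "u \<in> verts K"
    using K.tail_in_verts[OF a] inc by (simp add: u_def)
  then have "copy True u \<in> verts (associated_graph G)"
    using sets by auto
  then obtain C where C: "component C (associated_graph G)" and uC: "copy True u \<in> verts C"
    by (rule ex_component[OF AG])
  have main: "(\<exists>t. copy t v \<in> verts C) \<and>
      (\<forall>b\<in>arcs K. tail G b = v \<longrightarrow> copy True v \<in> verts C)" if v: "v \<in> verts K" for v
  proof (cases "v = u")
    case True
    then show ?thesis
      using uC by blast
  next
    case False
    then obtain ss where ss: "walk K u ss v" "alternating ss"
      using K u v unfolding special_def by metis
    then obtain s where s: "switching s (arc_directions ss)" and ne: "arc_directions ss \<noteq> []"
      by (auto simp: alternating_switching)
    define t where "t = (s = even (num_arcs ss))"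
    have "copy s u \<in> verts C"
    proof (cases s)
      case False
      then have "joined (associated_graph G) (copy True u) (copy False u)"
        using special_copies_joined[OF G K a, of ss v] ss s ne by (simp add: u_def)
      then show ?thesis
        using component_joined_copy[OF G C uC] False by simp
    qed (use uC in simp)
    then have vC: "copy t v \<in> verts C"
      using component_joined_copy[OF G C] walk_lift[OF G KG ss(1) s] t_def by blast
    have "copy True v \<in> verts C" if b: "b \<in> arcs K" "tail G b = v" for b
    proof (cases t)
      case False
      let ?rs = "rev (map reverse_step ss)"
      have "walk K v ?rs u"
        using walk_reverse[OF mK ss(1)] .
      moreover have "switching False (arc_directions ?rs)" "arc_directions ?rs \<noteq> []"
        using switching_reverse[OF s] False ne
        by (auto simp: arc_directions_reverse t_def num_arcs_def)
      ultimately have "joined (associated_graph G) (copy True v) (copy False v)"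
        using special_copies_joined[OF G K b(1)] b(2) by blast
      then show ?thesis
        using component_joined_copy[OF G C vC] joined_sym[OF AG] False by auto
    qed (use vC in simp)
    then show ?thesis
      using vC by blast
  qed
  have V: "verts K \<subseteq> verts (shadow G C)"
    using main by auto
  have E: "edges K \<subseteq> edges (shadow G C)"
  proof
    fix e assume e: "e \<in> edges K"
    obtain p q where pq: "ends G e = Upair p q"
      by (cases "ends G e")
    then have "p \<in> verts K"
      using K.ends_in_verts[OF e] inc by simp
    then obtain t where "copy t p \<in> verts C"
      using main by blast
    then have "Inl (copy t e) \<in> edges C"
      using component_edge_copy[OF G C, of e p t] e sets pq by auto
    then show "e \<in> edges (shadow G C)"
      by auto
  qed
  have A: "arcs K \<subseteq> arcs (shadow G C)"
  proof
    fix b assume b: "b \<in> arcs K"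
    have "tail G b \<in> verts K"
      using K.tail_in_verts[OF b] inc by simp
    then have "copy True (tail G b) \<in> verts C"
      using main b by blast
    then show "b \<in> arcs (shadow G C)"
      using component_arc_copy[OF G C, of b] b sets by auto
  qed
  have "submixed K (shadow G C)"
    using V E A mK inc unfolding submixed_def by simp
  with C show ?thesis
    by (rule that)
qed

lemma component_unique_arc:
  assumes G: "mixed_graph G"
    and C: "component C (associated_graph G)" "a \<in> arcs (shadow G C)"
    and D: "component D (associated_graph G)" "a \<in> arcs (shadow G D)"
  shows "C = D"
proof (rule component_unique[OF mixed_graph_associated[OF G] C(1) D(1)])
  show "copy True (tail G a) \<in> verts C"
    using arc_copies_in_verts(1)[OF component_submixed[OF C(1)]] C(2) by simp
  show "copy True (tail G a) \<in> verts D"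
    using arc_copies_in_verts(1)[OF component_submixed[OF D(1)]] D(2) by simp
qed

text \<open>Shadows with arcs are maximal special because a special submixed graph containing one lies in
  the shadow of a component with which it shares an arc, hence in the same shadow.\<close>

lemma type_III_iff:
  assumes G: "mixed_graph G"
  shows "type_III H G \<longleftrightarrow>
    arcs H \<noteq> {} \<and> (\<exists>C. component C (associated_graph G) \<and> shadow G C = H)"
proof
  assume H: "type_III H G"
  then have spec: "special H G"
    by (simp add: type_III_def)
  then have arcs: "arcs H \<noteq> {}"
    by (simp add: special_def)
  obtain C where C: "component C (associated_graph G)" "submixed H (shadow G C)"
    using special_subset_shadow[OF G spec] .
  then have "arcs (shadow G C) \<noteq> {}"
    using arcs unfolding submixed_def by blast
  then have "shadow G C = H"
    using special_shadow[OF G C(1)] C(2) H by (simp add: type_III_def)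
  then show "arcs H \<noteq> {} \<and> (\<exists>C. component C (associated_graph G) \<and> shadow G C = H)"
    using arcs C(1) by blast
next
  assume "arcs H \<noteq> {} \<and> (\<exists>C. component C (associated_graph G) \<and> shadow G C = H)"
  then obtain C a where C: "component C (associated_graph G)" and H: "shadow G C = H"
    and a: "a \<in> arcs H"
    by blast
  have "K = H" if K: "special K G" "submixed H K" for K
  proof -
    obtain D where D: "component D (associated_graph G)" "submixed K (shadow G D)"
      using special_subset_shadow[OF G K(1)] .
    have "a \<in> arcs (shadow G D)"
      using a K(2) D(2) unfolding submixed_def by blast
    then have "C = D"
      using component_unique_arc[OF G C _ D(1)] a H by blast
    then show ?thesis
      using D(2) K(2) H by (simp add: submixed_antisym)
  qed
  moreover have "special H G"
    using special_shadow[OF G C] a H by blast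
  ultimately show "type_III H G"
    by (simp add: type_III_def)
qed


section \<open>Counting components by their shadows\<close>

lemma type_I_or_II_no_arcs: "type_I H G \<or> type_II H G \<Longrightarrow> submixed H G \<and> arcs H = {}"
  by (auto simp: type_I_def type_II_def component_def submixed_undirected_part_iff)

text \<open>\<open>mixed_components\<close> counts \<open>H\<close> once for being a mixed component and once more for being an
  arc-free component of \<open>G\<close>. The latter makes up for \<open>H\<close> having both Type I and Type II.\<close>

lemma count_mixed_components:
  assumes G: "mixed_graph G"
  shows "count (mixed_components G) H =
    of_bool (type_I H G) + of_bool (type_II H G) + of_bool (type_III H G)"
proof -
  have "{H. mixed_component H G} \<subseteq> {H. submixed H G}"
    using type_I_or_II_no_arcs
    by (fastforce simp: mixed_component_def type_III_def special_def)
  then have fin: "finite {H. mixed_component H G}"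
    by (rule finite_subset) (rule finite_submixed[OF G])
  have "{H. component H G \<and> arcs H = {}} \<subseteq> {H. submixed H G}"
    by (auto simp: component_submixed)
  then have fin': "finite {H. component H G \<and> arcs H = {}}"
    by (rule finite_subset) (rule finite_submixed[OF G])
  have "\<not> (type_III H G \<and> (type_I H G \<or> type_II H G))"
    using type_I_or_II_no_arcs[of H G] type_III_iff[OF G, of H] by blast
  then show ?thesis
    using fin fin' type_I_and_II_iff[OF G, of H]
    by (auto simp: mixed_components_def mixed_component_def count_mset_set')
qed

text \<open>If \<open>H\<close> has no arcs, the components with shadow \<open>H\<close> can only be its copies on the two sheets.
  Otherwise they all contain the copy of some fixed arc of \<open>H\<close>, so there is at most one.\<close>

lemma card_components_with_shadow:
  assumes G: "mixed_graph G"
  shows "card {C \<in> {C. component C (associated_graph G)}. shadow G C = H} =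
    of_bool (type_I H G) + of_bool (type_II H G) + of_bool (type_III H G)"
    (is "card ?F = _")
proof (cases "arcs H = {}")
  case no_arcs: True
  have type: "(if s then type_I H G else type_II H G) \<longleftrightarrow>
      component (sheet G s H) (associated_graph G)" if "submixed H G" for s
    using component_sheet_iff[OF G that no_arcs, of s] type_I_iff[OF G] type_II_iff[OF G]
    by (cases s) auto
  have "?F = (if type_I H G then {sheet G True H} else {}) \<union>
      (if type_II H G then {sheet G False H} else {})"
  proof (intro equalityI subsetI)
    fix C assume "C \<in> ?F"
    then have C: "component C (associated_graph G)" "shadow G C = H"
      by auto
    then have H: "submixed H G"
      using submixed_shadow[OF G component_submixed] by blast
    obtain s where "C = sheet G s H"
      using component_without_arcs_is_sheet[OF G C(1)] C(2) no_arcs by blast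
    then show "C \<in> (if type_I H G then {sheet G True H} else {}) \<union>
        (if type_II H G then {sheet G False H} else {})"
      using type[OF H, of s] C(1) by (cases s) auto
  next
    fix C assume "C \<in> (if type_I H G then {sheet G True H} else {}) \<union>
        (if type_II H G then {sheet G False H} else {})"
    then obtain s where C: "C = sheet G s H" "if s then type_I H G else type_II H G"
      by (auto split: if_splits)
    then have "submixed H G"
      using type_I_or_II_no_arcs[of H G] by (auto split: if_splits)
    then show "C \<in> ?F"
      using C type shadow_sheet[OF _ no_arcs] by simp
  qed
  moreover have "sheet G True H \<noteq> sheet G False H" if "type_I H G"
  proof
    assume "sheet G True H = sheet G False H"
    then have "copy True ` verts H = copy False ` verts H"
      by (metis sheet_simps(1))
    moreover have "submixed H G"
      using type_I_or_II_no_arcs \<open>type_I H G\<close> by blast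
    then obtain v where "v \<in> verts H"
      by (auto simp: submixed_def mixed_graph_def)
    ultimately show False
      by (metis copy_mem_image)
  qed
  moreover have "\<not> type_III H G"
    using no_arcs type_III_iff[OF G] by blast
  ultimately show ?thesis
    by auto
next
  case False
  then obtain a where a: "a \<in> arcs H"
    by blast
  have "\<not> type_I H G" "\<not> type_II H G"
    using type_I_or_II_no_arcs[of H G] False by blast+
  moreover have "card ?F = of_bool (type_III H G)"
  proof (cases "type_III H G")
    case True
    then obtain C where C: "C \<in> ?F"
      using type_III_iff[OF G] by auto
    have "D = C" if "D \<in> ?F" for D
    proof (rule component_unique_arc[OF G])
      show "component D (associated_graph G)" "component C (associated_graph G)"
        using C that by simp_all
      show "a \<in> arcs (shadow G D)" "a \<in> arcs (shadow G C)"
        using C that a by (simp_all del: shadow_simps)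
    qed
    then have "?F = {C}"
      using C by blast
    then show ?thesis
      using True by simp
  next
    case not_III: False
    then have empty: "?F = {}"
      using type_III_iff[OF G] False by blast
    show ?thesis
      unfolding empty using not_III by simp
  qed
  ultimately show ?thesis
    by simp
qed

text \<open>The occurrences of \<open>x\<close> are numbered by the natural numbers below \<open>count M x\<close>, and can be matched
  with the fibre of \<open>p\<close> over \<open>x\<close> one \<open>x\<close> at a time.\<close>

lemma bij_betw_occurrences:
  assumes fin: "finite A" and card: "\<And>x. card {c \<in> A. p c = x} = count M x"
  shows "\<exists>f. bij_betw f (occurrences M) A"
proof -
  have "\<exists>h. bij_betw h {..<count M x} {c \<in> A. p c = x}" for x
    using fin card[of x] by (intro finite_same_card_bij) auto
  then obtain h where h: "\<And>x. bij_betw (h x) {..<count M x} {c \<in> A. p c = x}"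
    by metis
  have "bij_betw (\<lambda>(x, i). h x i) (occurrences M) A"
    unfolding bij_betw_def
  proof
    have p: "p (h x i) = x" "h x i \<in> A" if "i < count M x" for x i
      using bij_betwE[OF h[of x]] that by auto
    show "inj_on (\<lambda>(x, i). h x i) (occurrences M)"
    proof (rule inj_onI, clarify)
      fix x i y j
      assume i: "(x, i) \<in> occurrences M" and j: "(y, j) \<in> occurrences M" and eq: "h x i = h y j"
      then have "x = y"
        using p[of i x] p[of j y] by (simp add: occurrences_def)
      moreover from this have "i = j"
        using inj_onD[OF bij_betw_imp_inj_on[OF h[of x]]] i j eq by (auto simp: occurrences_def)
      ultimately show "x = y \<and> i = j" ..
    qed
    show "(\<lambda>(x, i). h x i) ` occurrences M = A"
    proof (intro equalityI subsetI)
      fix c assume "c \<in> A"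
      then have "c \<in> h (p c) ` {..<count M (p c)}"
        using bij_betw_imp_surj_on[OF h[of "p c"]] by auto
      then show "c \<in> (\<lambda>(x, i). h x i) ` occurrences M"
        by (force simp: occurrences_def)
    qed (use p in \<open>auto simp: occurrences_def\<close>)
  qed
  then show ?thesis
    by blast
qed

theorem theorem6p1:
  fixes G :: "('v, 'e, 'a) pre_mixed_graph"
  assumes "mixed_graph G"
  shows "\<exists>f. bij_betw f (occurrences (mixed_components G)) {C. component C (associated_graph G)}"
proof (rule bij_betw_occurrences)
  have "{C. component C (associated_graph G)} \<subseteq> {C. submixed C (associated_graph G)}"
    by (auto simp: component_submixed)
  then show "finite {C. component C (associated_graph G)}"
    by (rule finite_subset) (rule finite_submixed[OF mixed_graph_associated[OF assms]])
  show "card {C \<in> {C. component C (associated_graph G)}. shadow G C = H} =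
      count (mixed_components G) H" for H
    using card_components_with_shadow[OF assms] count_mixed_components[OF assms] by simp
qed

end
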